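(* Consider the end effector $x_{e,k+1}=x_{e,k}+t_sJ_e(\theta_k)u_k$, the safe set $\mathbb S_e=\{x_{e,k}\in\mathbb X_e : h_{e,k}\ge 0\}$ with $h_{e,k}=\|x_{e,k}-o_k\|-d_{\min}-R_o$, and the observer described in the context, with estimate $\hat o_k=\xi_{1,k}$ of the obstacle position $o_k$. At time step $k$, given $x_{e,k}\in\mathbb S_e$ and $H(x_{e,k},o_k)\ge 0$, let the flexible safety criterion (CBFSC) be $$\Delta H(x_{e,k},u_k,o_k)+\gamma_k H(x_{e,k},o_k)\ge 0,\qquad 0<\gamma_k\le 1,$$ where $\Delta H(x_{e,k},u_k,o_k)=H(x_{e,k+1},\hat o_{k+1})-H(x_{e,k},o_k)$ and $\gamma_k$ is a variable to be optimized. Then any feasible controller $u_k\in\mathbb U$ that satisfies the CBFSC (for all $k\in\mathbb N_{\ge 0}$) guarantees that the safe set $\mathbb S_e$ is forward invariant for the end effector, i.e. starting from $x_{e,0}\in\mathbb S_e$ one has $x_{e,k}\in\mathbb S_e$ for all $k\in\mathbb N_{\ge 0}$.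
   Context: Throughout, $\|\cdot\|$ is the Euclidean norm and $t_s>0$ is the sampling period. **Forward invariance and discrete-time exponential control barrier functions.** For a system $x_{k+1}=f(x_k,u_k)$ with $x_k\in\mathbb Q$, $u_k\in U$, a set $\mathbb C=\{x_k\in\mathbb Q : B(x_k)\ge 0\}$ ($B$ continuous) is forward invariant if for any $x_0\in\mathbb C$ one has $x_k\in\mathbb C$ for all $k\in\mathbb N_{\ge 0}$. The function $B$ is a discrete-time exponential control barrier function if $B(x_0)\ge 0$ and there exists $u_k\in U$ such that $B(x_{k+1})-B(x_k)+\gamma B(x_k)\ge 0$ for all $k\in\mathbb N_{\ge 0}$, where $0<\gamma\le 1$ is the decay rate. The theorem is stated on the basis of this notion. **Robot.** $x_{e,k}\in\mathbb X_e\subset\mathbb R^7$ is the end-effector pose at time step $k$ (position and quaternion); $u_k\in\mathbb U\subset\mathbb R^n$ is the joint velocity (control input); $\theta_k\in\mathbb R^n$ is the joint position; $J_e(\theta_k)$ is the end-effector Jacobian matrix. In $\|x_e-o\|$ with $o\in\mathbb R^3$, $x_e$ stands for its position part in $\mathbb R^3$. **Obstacle.** The obstacle is a ball with centre $o_k\in\mathbb R^3$ and radius $R_o$. Put $D_k=(o_k,l_{1,k},\dots,l_{m-1,k})$, where $l_{1,k},\dots,l_{m-1,k}$ are the higher-order differences of $o_k$ and $l_{m,k}=0$. It is assumed that $D_{k+1}=AD_k$ and $o_k=CD_k$, i.e., with $l_{0,k}=o_k$: $l_{i,k+1}=l_{i,k}+t_s l_{i+1,k}$ for $0\le i\le m-2$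 and $l_{m-1,k+1}=l_{m-1,k}$; $C$ extracts the first block. The safe set $\mathbb S_e$ depends on $k$ through $o_k$: the condition $x_{e,k}\in\mathbb S_e$ means $\|x_{e,k}-o_k\|-d_{\min}-R_o\ge 0$, where $d_{\min}$ is the minimum safe distance between robot and obstacle. **Observer.** With gains $\alpha_1,\dots,\alpha_m$ and states $\xi_{i,k}\in\mathbb R^3$: $$\xi_{i,k+1}=\xi_{i,k}+t_s[\xi_{i+1,k}+\alpha_i(o_k-\xi_{1,k})]\ (1\le i\le m-1),\qquad \xi_{m,k+1}=\xi_{m,k}+t_s\alpha_m(o_k-\xi_{1,k}),$$ and $\hat o_k:=\xi_{1,k}$. The estimation errors are $\epsilon_{1,k}=o_k-\xi_{1,k}$ and $\epsilon_{i,k}=l_{i-1,k}-\xi_{i,k}$ for $2\le i\le m$; $E_k=(\epsilon_{1,k},\dots,\epsilon_{m,k})$ satisfies $E_{k+1}=\Phi E_k$, where $\Phi$ is the $m\times m$ matrix (acting blockwise on $\mathbb R^3$-valued entries) with first column $(1-t_s\alpha_1,-t_s\alpha_2,\dots,-t_s\alpha_m)^{\rm T}$, diagonal entries $1$ in positions $2,\dots,m$, entries $t_s$ on the superdiagonal, and zeros elsewhere. The gains are chosen so that the spectral radius satisfies $\rho(\Phi)<1$. Let $\rho(\Phi)<\eta<1$ and let $W$ (symmetric positive definite) solve $\Phi^{\rm T}W\Phi-\eta^2W\preceq 0$. Put $c_1=\lambda_{\min}(W)$, $c_2=\lambda_{\max}(W)$, $\phi_k=\eta^k\sqrt{c_2/c_1}$,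 and let $\delta$ be a known upper bound of $\|E_0\|$. **Safety distance.** Let $r_d=\delta\phi_0$, $r_{\rm safe}=d_{\min}+R_o+r_d$, and $H(x,o)=\|x-o\|-r_{\rm safe}$. *)

theory Defs
  imports "HOL-Analysis.Analysis" "Jordan_Normal_Form.Spectral_Radius"
begin

(* A system is represented by the set of its state trajectories; the set to be kept invariant may
   depend on time. *)
definition forward_invariant :: "(nat \<Rightarrow> 'a) set \<Rightarrow> (nat \<Rightarrow> 'a set) \<Rightarrow> bool" where
  "forward_invariant T S \<longleftrightarrow> (\<forall>x\<in>T. x 0 \<in> S 0 \<longrightarrow> (\<forall>k. x k \<in> S k))"

(* l i k is the i-th difference l_{i,k}; the convention l_{m,k} = 0 makes the last component of
   (l 0 k, ..., l (m - 1) k) constant in k. *)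
definition obstacle_model ::
    "real \<Rightarrow> nat \<Rightarrow> (nat \<Rightarrow> real ^ 3) \<Rightarrow> (nat \<Rightarrow> nat \<Rightarrow> real ^ 3) \<Rightarrow> bool" where
  "obstacle_model ts m ob l \<longleftrightarrow>
     (\<forall>k. l 0 k = ob k \<and> l m k = 0 \<and>
          (\<forall>i<m. l i (Suc k) = l i k + ts *\<^sub>R l (Suc i) k))"

(* \<alpha> i and \<xi> i k are used for 1 \<le> i \<le> m only. *)
definition observer ::
    "real \<Rightarrow> nat \<Rightarrow> (nat \<Rightarrow> real) \<Rightarrow> (nat \<Rightarrow> real ^ 3) \<Rightarrow> (nat \<Rightarrow> nat \<Rightarrow> real ^ 3) \<Rightarrow> bool" where
  "observer ts m \<alpha> ob \<xi> \<longleftrightarrow>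
     (\<forall>k. (\<forall>i. 1 \<le> i \<and> i < m \<longrightarrow>
              \<xi> i (Suc k) = \<xi> i k + ts *\<^sub>R (\<xi> (Suc i) k + \<alpha> i *\<^sub>R (ob k - \<xi> 1 k))) \<and>
          \<xi> m (Suc k) = \<xi> m k + (ts * \<alpha> m) *\<^sub>R (ob k - \<xi> 1 k))"

definition est_error ::
    "(nat \<Rightarrow> nat \<Rightarrow> real ^ 3) \<Rightarrow> (nat \<Rightarrow> nat \<Rightarrow> real ^ 3) \<Rightarrow> nat \<Rightarrow> nat \<Rightarrow> real ^ 3" where
  "est_error l \<xi> i k = l (i - 1) k - \<xi> i k"

(* Euclidean norm of the stacked vector of the m estimation errors at step k. *)
definition est_error_norm ::
    "nat \<Rightarrow> (nat \<Rightarrow> nat \<Rightarrow> real ^ 3) \<Rightarrow> (nat \<Rightarrow> nat \<Rightarrow> real ^ 3) \<Rightarrow> nat \<Rightarrow> real" where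
  "est_error_norm m l \<xi> k = L2_set (\<lambda>i. norm (est_error l \<xi> i k)) {1..m}"

(* Matrix indices start at 0 here, the gains at 1. *)
definition error_mat :: "real \<Rightarrow> nat \<Rightarrow> (nat \<Rightarrow> real) \<Rightarrow> real mat" where
  "error_mat ts m \<alpha> = mat m m (\<lambda>(i, j).
     if j = 0 then (if i = 0 then 1 - ts * \<alpha> 1 else - ts * \<alpha> (Suc i))
     else if j = i then 1
     else if j = Suc i then ts
     else 0)"

definition sym_pos_def_mat :: "nat \<Rightarrow> real mat \<Rightarrow> bool" where
  "sym_pos_def_mat n A \<longleftrightarrow> A \<in> carrier_mat n n \<and> transpose_mat A = A \<and>
     (\<forall>v \<in> carrier_vec n. v \<noteq> 0\<^sub>v n \<longrightarrow> 0 < scalar_prod v (A *\<^sub>v v))"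

definition neg_semidef_mat :: "nat \<Rightarrow> real mat \<Rightarrow> bool" where
  "neg_semidef_mat n A \<longleftrightarrow> A \<in> carrier_mat n n \<and> transpose_mat A = A \<and>
     (\<forall>v \<in> carrier_vec n. scalar_prod v (A *\<^sub>v v) \<le> 0)"

(* Meant for symmetric matrices of positive size, whose real spectrum is finite and nonempty. *)
definition lambda_min :: "real mat \<Rightarrow> real" where
  "lambda_min A = Min (spectrum A)"

definition lambda_max :: "real mat \<Rightarrow> real" where
  "lambda_max A = Max (spectrum A)"

definition phi :: "real mat \<Rightarrow> real \<Rightarrow> nat \<Rightarrow> real" where
  "phi W \<eta> k = \<eta> ^ k * sqrt (lambda_max W / lambda_min W)"

definition r_safe :: "real \<Rightarrow> real \<Rightarrow> real \<Rightarrow> real mat \<Rightarrow> real \<Rightarrow> real" where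
  "r_safe dmin Ro \<delta> W \<eta> = dmin + Ro + \<delta> * phi W \<eta> 0"

(* A pose consists of the position (components 1 to 3) and a quaternion (components 4 to 7). *)
definition ee_pos :: "real ^ 7 \<Rightarrow> real ^ 3" where
  "ee_pos x = vector [vec_nth x 1, vec_nth x 2, vec_nth x 3]"

definition ee_step ::
    "real \<Rightarrow> (real ^ 'n \<Rightarrow> real ^ 'n ^ 7) \<Rightarrow> real ^ 'n \<Rightarrow> real ^ 7 \<Rightarrow> real ^ 'n \<Rightarrow> real ^ 7" where
  "ee_step ts J \<theta> x u = x + ts *\<^sub>R (J \<theta> *v u)"

definition ee_trajectory ::
    "real \<Rightarrow> (real ^ 'n \<Rightarrow> real ^ 'n ^ 7) \<Rightarrow> (real ^ 7) set \<Rightarrow> (real ^ 'n) set \<Rightarrow>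
     (nat \<Rightarrow> real ^ 'n) \<Rightarrow> (nat \<Rightarrow> real ^ 7) \<Rightarrow> (nat \<Rightarrow> real ^ 'n) \<Rightarrow> bool" where
  "ee_trajectory ts J Xe U \<theta> x u \<longleftrightarrow>
     (\<forall>k. x k \<in> Xe \<and> u k \<in> U \<and> x (Suc k) = ee_step ts J (\<theta> k) (x k) (u k))"

definition h_e :: "real \<Rightarrow> real \<Rightarrow> real ^ 7 \<Rightarrow> real ^ 3 \<Rightarrow> real" where
  "h_e dmin Ro x c = norm (ee_pos x - c) - dmin - Ro"

definition safe_set ::
    "real \<Rightarrow> real \<Rightarrow> (real ^ 7) set \<Rightarrow> (nat \<Rightarrow> real ^ 3) \<Rightarrow> nat \<Rightarrow> (real ^ 7) set" where
  "safe_set dmin Ro Xe ob k = {x \<in> Xe. h_e dmin Ro x (ob k) \<ge> 0}"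

definition H :: "real \<Rightarrow> real ^ 7 \<Rightarrow> real ^ 3 \<Rightarrow> real" where
  "H r x c = norm (ee_pos x - c) - r"

(* The next pose is compared with the estimate of the next obstacle position, the current pose with
   the true current obstacle position. *)
definition CBFSC ::
    "real \<Rightarrow> (real ^ 'n \<Rightarrow> real ^ 'n ^ 7) \<Rightarrow> real \<Rightarrow> (nat \<Rightarrow> real ^ 3) \<Rightarrow> (nat \<Rightarrow> nat \<Rightarrow> real ^ 3) \<Rightarrow>
     (nat \<Rightarrow> real ^ 'n) \<Rightarrow> (nat \<Rightarrow> real ^ 7) \<Rightarrow> (nat \<Rightarrow> real ^ 'n) \<Rightarrow> (nat \<Rightarrow> real) \<Rightarrow> nat \<Rightarrow> bool" where
  "CBFSC ts J r ob \<xi> \<theta> x u \<gamma> k \<longleftrightarrow>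
     0 < \<gamma> k \<and> \<gamma> k \<le> 1 \<and>
     (H r (ee_step ts J (\<theta> k) (x k) (u k)) (\<xi> 1 (Suc k)) - H r (x k) (ob k))
       + \<gamma> k * H r (x k) (ob k) \<ge> 0"

(* End-effector trajectories driven by controllers which, at each step that starts in the safe set
   S k, have H \<ge> 0 available there and satisfy the criterion CBFSC for some decay rate. *)
definition cbfsc_trajectories ::
    "real \<Rightarrow> (real ^ 'n \<Rightarrow> real ^ 'n ^ 7) \<Rightarrow> (real ^ 7) set \<Rightarrow> (real ^ 'n) set \<Rightarrow> real \<Rightarrow>
     (nat \<Rightarrow> real ^ 3) \<Rightarrow> (nat \<Rightarrow> nat \<Rightarrow> real ^ 3) \<Rightarrow> (nat \<Rightarrow> (real ^ 7) set) \<Rightarrow> (nat \<Rightarrow> real ^ 7) set" where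
  "cbfsc_trajectories ts J Xe U r ob \<xi> S =
     {x. \<exists>\<theta> u \<gamma>. ee_trajectory ts J Xe U \<theta> x u \<and>
           (\<forall>k. x k \<in> S k \<longrightarrow> H r (x k) (ob k) \<ge> 0 \<and> CBFSC ts J r ob \<xi> \<theta> x u \<gamma> k)}"

end

theory Submission
  imports Defs
begin

text \<open>The quadratic form of W, summed over the three coordinates of the stacked error, contracts by
  the square of \<eta> in each step. Sandwiched between lambda_min W and lambda_max W times the squared
  error norm, it bounds the estimation error at every step by \<delta> * phi W \<eta> 0, which is exactly the
  margin that r_safe adds to dmin + Ro. The criterion keeps the end effector at distance r_safe from
  the estimate, so by the triangle inequality it keeps a safe distance from the true obstacle.\<close>

section \<open>Rayleigh bounds\<close>

lemma scalar_prod_mult_mat_vec_sum: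
  fixes A :: "'a :: comm_semiring_0 mat"
  assumes "A \<in> carrier_mat n n" "v \<in> carrier_vec n" "w \<in> carrier_vec n"
  shows "scalar_prod v (A *\<^sub>v w) =
    (\<Sum>i<n. \<Sum>j<n. A $$ (i, j) * vec_index v i * vec_index w j)"
proof -
  have "scalar_prod v (A *\<^sub>v w) =
      (\<Sum>i<n. vec_index v i * (\<Sum>j<n. A $$ (i, j) * vec_index w j))"
    using assms by (auto simp: scalar_prod_def atLeast0LessThan intro!: sum.cong)
  then show ?thesis
    by (simp add: sum_distrib_left mult_ac)
qed

lemma symmetric_mat_scalar_prod:
  fixes A :: "'a :: comm_semiring_0 mat"
  assumes "A \<in> carrier_mat n n" "transpose_mat A = A" "v \<in> carrier_vec n" "w \<in> carrier_vec n"
  shows "scalar_prod v (A *\<^sub>v w) = scalar_prod w (A *\<^sub>v v)"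
proof -
  have sym: "A $$ (i, j) = A $$ (j, i)" if "i < n" "j < n" for i j
    using assms(1,2) that by (metis carrier_matD index_transpose_mat(1))
  have "scalar_prod v (A *\<^sub>v w) =
      (\<Sum>j<n. \<Sum>i<n. A $$ (i, j) * vec_index v i * vec_index w j)"
    unfolding scalar_prod_mult_mat_vec_sum[OF assms(1,3,4)] by (rule sum.swap)
  also have "\<dots> = (\<Sum>j<n. \<Sum>i<n. A $$ (j, i) * vec_index w j * vec_index v i)"
    using sym by (intro sum.cong) (auto simp: mult_ac)
  finally show ?thesis
    unfolding scalar_prod_mult_mat_vec_sum[OF assms(1,4,3)] .
qed

lemma smult_mat_mult_vec:
  fixes A :: "'a :: comm_semiring_0 mat"
  assumes "A \<in> carrier_mat n k" "v \<in> carrier_vec k"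
  shows "(c \<cdot>\<^sub>m A) *\<^sub>v v = c \<cdot>\<^sub>v (A *\<^sub>v v)"
  using assms by (intro eq_vecI) (auto simp: scalar_prod_def sum_distrib_left mult_ac)

lemma scalar_prod_self_sum:
  fixes v :: "real Matrix.vec"
  assumes "v \<in> carrier_vec n"
  shows "scalar_prod v v = (\<Sum>i<n. (vec_index v i)\<^sup>2)"
  using assms by (simp add: scalar_prod_def atLeast0LessThan power2_eq_square)

lemma scalar_prod_self_nonneg:
  fixes v :: "real Matrix.vec"
  shows "0 \<le> scalar_prod v v"
  by (simp add: scalar_prod_def sum_nonneg)

lemma scalar_prod_self_pos:
  fixes v :: "real Matrix.vec"
  assumes "v \<in> carrier_vec n" "v \<noteq> 0\<^sub>v n"
  shows "0 < scalar_prod v v"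
proof -
  obtain i where "i < n" "vec_index v i \<noteq> 0"
    using assms by (metis carrier_vecD eq_vecI index_zero_vec)
  then show ?thesis
    unfolding scalar_prod_self_sum[OF assms(1)] by (intro sum_pos2[of _ i]) auto
qed

text \<open>Perturb v in the direction w = A v. Along v + t w the form is a quadratic in t without
  constant term, with linear coefficient twice the squared length of w. If w were nonzero, a
  suitable negative t would make the form negative.\<close>

lemma psd_form_zero_imp_kernel:
  fixes A :: "real mat"
  assumes A: "A \<in> carrier_mat n n" "transpose_mat A = A"
    and psd: "\<And>v. v \<in> carrier_vec n \<Longrightarrow> 0 \<le> scalar_prod v (A *\<^sub>v v)"
    and v: "v \<in> carrier_vec n" "scalar_prod v (A *\<^sub>v v) = 0"
  shows "A *\<^sub>v v = 0\<^sub>v n"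
proof (rule ccontr)
  define w where "w = A *\<^sub>v v"
  have w: "w \<in> carrier_vec n" using A v by (simp add: w_def)
  assume "A *\<^sub>v v \<noteq> 0\<^sub>v n"
  then have pos: "0 < scalar_prod w w"
    using scalar_prod_self_pos[OF w] by (simp add: w_def)
  define q where "q = scalar_prod w (A *\<^sub>v w)"
  have q: "0 \<le> q" using psd w by (simp add: q_def)
  have key: "0 \<le> 2 * t * scalar_prod w w + t\<^sup>2 * q" for t
  proof -
    have "0 \<le> scalar_prod (v + t \<cdot>\<^sub>v w) (A *\<^sub>v (v + t \<cdot>\<^sub>v w))"
      using v w by (intro psd) auto
    also have "\<dots> = scalar_prod (v + t \<cdot>\<^sub>v w) (A *\<^sub>v v + t \<cdot>\<^sub>v (A *\<^sub>v w))"
      using A v w by (simp add: mult_add_distrib_mat_vec[of _ n n] mult_mat_vec[of _ n n])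
    also have "\<dots> = scalar_prod v (A *\<^sub>v v) + t * scalar_prod v (A *\<^sub>v w)
        + t * scalar_prod w (A *\<^sub>v v) + t * t * q"
      using A v w
      by (simp add: q_def add_scalar_prod_distrib[of _ n] scalar_prod_add_distrib[of _ n]
          algebra_simps)
    also have "\<dots> = 2 * t * scalar_prod w w + t\<^sup>2 * q"
      using symmetric_mat_scalar_prod[OF A v(1) w] v(2)
      by (simp add: w_def power2_eq_square)
    finally show ?thesis .
  qed
  \<comment> \<open>Close to the minimiser of the quadratic; the denominator q + 1 stays positive
    even when q = 0. At this t the quadratic has the value - t^2 (q + 2).\<close>
  define t where "t = - scalar_prod w w / (q + 1)"
  have t: "scalar_prod w w = - (t * (q + 1))" using q by (simp add: t_def)
  have "2 * t * scalar_prod w w + t\<^sup>2 * q = - (t\<^sup>2 * (q + 2))"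
    unfolding t by (simp add: power2_eq_square algebra_simps)
  moreover have "0 < t\<^sup>2 * (q + 2)" using q pos by (simp add: t_def)
  ultimately show False using key[of t] by simp
qed

text \<open>A minimiser of the form on the unit sphere lies in the kernel of the positive semidefinite
  matrix A - \<mu> I, so it is an eigenvector.\<close>

lemma rayleigh_minimum:
  fixes A :: "real mat"
  assumes A: "A \<in> carrier_mat n n" "transpose_mat A = A" and n: "0 < n"
  obtains \<mu> where "eigenvalue A \<mu>"
    "\<And>v. v \<in> carrier_vec n \<Longrightarrow> \<mu> * scalar_prod v v \<le> scalar_prod v (A *\<^sub>v v)"
proof -
  define Q where "Q f = (\<Sum>i<n. \<Sum>j<n. A $$ (i, j) * f i * f j)" for f :: "nat \<Rightarrow> real"
  \<comment> \<open>Functions vanishing from n on stand for vectors of length n. The cube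
    \<open>B\<close> is compact as a product of compact sets, and \<open>K\<close>, the unit sphere
    inside it, is a closed part of it.\<close>
  define B :: "(nat \<Rightarrow> real) set"
    where "B = PiE UNIV (\<lambda>i. if i < n then {-1..1} else {0})"
  define K where "K = B \<inter> {f. (\<Sum>i<n. (f i)\<^sup>2) = 1}"
  have "compact B"
  proof -
    have "compactin (product_topology (\<lambda>i. euclidean) UNIV) B"
      unfolding B_def by (subst compactin_PiE) auto
    then show ?thesis
      by (simp add: euclidean_product_topology)
  qed
  moreover have "closed {f :: nat \<Rightarrow> real. (\<Sum>i<n. (f i)\<^sup>2) = 1}"
    by (intro closed_Collect_eq continuous_intros continuous_on_product_coordinates)
  ultimately have "compact K" unfolding K_def by (rule compact_Int_closed)
  moreover have "K \<noteq> {}"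
  proof -
    have "(\<Sum>i<n. (if i = 0 then 1 else 0 :: real)\<^sup>2) = (\<Sum>i<n. if i = 0 then 1 else 0)"
      by (intro sum.cong) auto
    then have "(\<lambda>i. if i = 0 then 1 else 0) \<in> K"
      using n by (auto simp: K_def B_def)
    then show ?thesis by blast
  qed
  moreover have "continuous_on K Q"
    unfolding Q_def
    by (intro continuous_intros continuous_on_subset[OF continuous_on_product_coordinates]) auto
  ultimately obtain f where f: "f \<in> K" and min: "\<And>g. g \<in> K \<Longrightarrow> Q f \<le> Q g"
    using continuous_attains_inf by metis
  define \<mu> where "\<mu> = Q f"
  define e where "e = Matrix.vec n f"
  have e: "e \<in> carrier_vec n" by (simp add: e_def)
  have ee: "scalar_prod e e = 1"
    using f by (simp add: scalar_prod_self_sum[OF e]) (simp add: e_def K_def)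
  have Ae: "scalar_prod e (A *\<^sub>v e) = \<mu>"
    unfolding scalar_prod_mult_mat_vec_sum[OF A(1) e e] by (simp add: e_def \<mu>_def Q_def)
  have bound: "\<mu> * scalar_prod v v \<le> scalar_prod v (A *\<^sub>v v)" if v: "v \<in> carrier_vec n" for v
  proof (cases "v = 0\<^sub>v n")
    case True
    then show ?thesis using A by (simp add: scalar_prod_def)
  next
    case False
    define s where "s = sqrt (scalar_prod v v)"
    have s: "0 < s" "s\<^sup>2 = scalar_prod v v" "scalar_prod v v \<noteq> 0"
      using scalar_prod_self_pos[OF v False] by (auto simp: s_def)
    \<comment> \<open>Both sides of the bound are homogeneous of degree two, so it is enough to
      compare at v scaled to length one.\<close>
    define g where "g i = (if i < n then vec_index v i / s else 0)" for i
    have one: "(\<Sum>i<n. (g i)\<^sup>2) = 1"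
      using s by (simp add: g_def power_divide flip: scalar_prod_self_sum[OF v] sum_divide_distrib)
    \<comment> \<open>Each single square is at most the whole sum, which is 1; hence the scaled
      vector lies in the cube.\<close>
    have "- 1 \<le> g i \<and> g i \<le> 1" if "i < n" for i
    proof -
      have "(g i)\<^sup>2 \<le> (\<Sum>i<n. (g i)\<^sup>2)" using that by (intro member_le_sum) auto
      then show ?thesis using one by (simp add: abs_square_le_1 abs_le_iff)
    qed
    moreover have "g i = 0" if "\<not> i < n" for i using that by (simp add: g_def)
    ultimately have "g \<in> K" using one by (auto simp: K_def B_def)
    then have "\<mu> \<le> Q g" using min by (simp add: \<mu>_def)
    also have "Q g = scalar_prod v (A *\<^sub>v v) / s\<^sup>2"
      unfolding scalar_prod_mult_mat_vec_sum[OF A(1) v v]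
      by (simp add: Q_def g_def power2_eq_square sum_divide_distrib)
    finally show ?thesis using s(1) by (simp add: pos_le_divide_eq flip: s(2))
  qed
  define N where "N = A - \<mu> \<cdot>\<^sub>m 1\<^sub>m n"
  have N: "N \<in> carrier_mat n n" unfolding N_def by (intro minus_carrier_mat) simp
  have symN: "transpose_mat N = N"
  proof (rule eq_matI)
    fix i j assume "i < dim_row N" "j < dim_col N"
    then have ij: "i < n" "j < n" using N by auto
    have "A $$ (j, i) = A $$ (i, j)"
      using A ij by (metis carrier_matD index_transpose_mat(1))
    then show "transpose_mat N $$ (i, j) = N $$ (i, j)"
      using A ij N by (auto simp: N_def)
  qed (use N in auto)
  have Nv: "N *\<^sub>v v = A *\<^sub>v v - \<mu> \<cdot>\<^sub>v v" if "v \<in> carrier_vec n" for v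
    using A that unfolding N_def
    by (subst minus_mult_distrib_mat_vec[of _ n n]) (auto simp: smult_mat_mult_vec[of _ n n])
  have Nform: "scalar_prod v (N *\<^sub>v v) = scalar_prod v (A *\<^sub>v v) - \<mu> * scalar_prod v v"
    if "v \<in> carrier_vec n" for v
    using A that by (simp add: Nv scalar_prod_minus_distrib[of _ n])
  \<comment> \<open>The form of \<open>N\<close> is nonnegative by \<open>bound\<close>, and at the
    unit vector e it equals \<mu> - \<mu> = 0.\<close>
  have "N *\<^sub>v e = 0\<^sub>v n"
    using bound by (intro psd_form_zero_imp_kernel[OF N symN _ e]) (auto simp: Nform e Ae ee)
  then have zero: "A *\<^sub>v e - \<mu> \<cdot>\<^sub>v e = 0\<^sub>v n" by (simp add: Nv e)
  have "A *\<^sub>v e = \<mu> \<cdot>\<^sub>v e"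
  proof (rule eq_vecI)
    fix i assume "i < dim_vec (\<mu> \<cdot>\<^sub>v e)"
    then have "i < n" using e by simp
    then have "vec_index (A *\<^sub>v e - \<mu> \<cdot>\<^sub>v e) i = 0" using zero by simp
    then show "vec_index (A *\<^sub>v e) i = vec_index (\<mu> \<cdot>\<^sub>v e) i"
      using A e \<open>i < n\<close> by simp
  qed (use A e in simp)
  moreover have "e \<noteq> 0\<^sub>v n" using ee by auto
  ultimately have "eigenvalue A \<mu>"
    using A e by (auto simp: eigenvalue_def eigenvector_def)
  then show thesis using bound that by blast
qed

text \<open>The constant from \<open>rayleigh_minimum\<close> is an eigenvalue, hence at least the
  minimum of the finite spectrum; this inequality already suffices, without identifying the
  two.\<close>

lemma lambda_min_bound:
  assumes "A \<in> carrier_mat n n" "transpose_mat A = A" "0 < n" "v \<in> carrier_vec n"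
  shows "lambda_min A * scalar_prod v v \<le> scalar_prod v (A *\<^sub>v v)"
proof -
  obtain \<mu> where \<mu>: "eigenvalue A \<mu>" "\<mu> * scalar_prod v v \<le> scalar_prod v (A *\<^sub>v v)"
    using rayleigh_minimum[OF assms(1-3)] assms(4) by metis
  have "lambda_min A \<le> \<mu>"
    using \<mu>(1) card_finite_spectrum(1)[OF assms(1)]
    by (auto simp: lambda_min_def spectrum_def intro!: Min_le)
  then show ?thesis
    using \<mu>(2) mult_right_mono[OF _ scalar_prod_self_nonneg] by (meson order_trans)
qed

text \<open>Apply \<open>rayleigh_minimum\<close> to - A: the negative of the eigenvalue found there
  is an eigenvalue of A, so it lies below the maximum of the spectrum.\<close>

lemma lambda_max_bound:
  assumes A: "A \<in> carrier_mat n n" "transpose_mat A = A" and n: "0 < n" and v: "v \<in> carrier_vec n"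
  shows "scalar_prod v (A *\<^sub>v v) \<le> lambda_max A * scalar_prod v v"
proof -
  have neg: "(- A) *\<^sub>v w = - (A *\<^sub>v w)" if "w \<in> carrier_vec n" for w
    using A that by (intro eq_vecI) auto
  have sym: "transpose_mat (- A) = - A"
    using A by (metis transpose_uminus)
  obtain \<mu> where \<mu>: "eigenvalue (- A) \<mu>"
      "\<mu> * scalar_prod v v \<le> scalar_prod v ((- A) *\<^sub>v v)"
    using rayleigh_minimum[OF _ sym n] A v by (metis uminus_carrier_iff_mat)
  from \<mu>(1) obtain w where w: "w \<in> carrier_vec n" "w \<noteq> 0\<^sub>v n" "- (A *\<^sub>v w) = \<mu> \<cdot>\<^sub>v w"
    using A by (auto simp: eigenvalue_def eigenvector_def neg)
  have "A *\<^sub>v w = - (\<mu> \<cdot>\<^sub>v w)"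
    using w(3) by (metis uminus_uminus_vec)
  then have "A *\<^sub>v w = (- \<mu>) \<cdot>\<^sub>v w"
    using w(1) by (intro eq_vecI) auto
  then have "eigenvalue A (- \<mu>)"
    using A w by (auto simp: eigenvalue_def eigenvector_def)
  then have "- \<mu> \<le> lambda_max A"
    using card_finite_spectrum(1)[OF A(1)]
    by (auto simp: lambda_max_def spectrum_def intro!: Max_ge)
  then have "(- \<mu>) * scalar_prod v v \<le> lambda_max A * scalar_prod v v"
    by (rule mult_right_mono[OF _ scalar_prod_self_nonneg])
  moreover have "scalar_prod v ((- A) *\<^sub>v v) = - scalar_prod v (A *\<^sub>v v)"
    using A v by (simp add: neg)
  ultimately show ?thesis using \<mu>(2) by simp
qed

text \<open>The spectrum is finite and, by \<open>rayleigh_minimum\<close>, nonempty, so its minimum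
  is an eigenvalue itself. Positive definiteness is then evaluated at an eigenvector for it.\<close>

lemma lambda_min_pos:
  assumes "sym_pos_def_mat n A" "0 < n"
  shows "0 < lambda_min A"
proof -
  have A: "A \<in> carrier_mat n n" "transpose_mat A = A"
    using assms by (auto simp: sym_pos_def_mat_def)
  obtain \<mu> where "eigenvalue A \<mu>" using rayleigh_minimum[OF A assms(2)] by metis
  then have "lambda_min A \<in> spectrum A"
    using card_finite_spectrum(1)[OF A(1)] unfolding lambda_min_def
    by (intro Min_in) (auto simp: spectrum_def)
  then obtain v where v: "v \<in> carrier_vec n" "v \<noteq> 0\<^sub>v n" "A *\<^sub>v v = lambda_min A \<cdot>\<^sub>v v"
    using A by (auto simp: spectrum_def eigenvalue_def eigenvector_def)
  then have "0 < lambda_min A * scalar_prod v v"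
    using assms(1) by (auto simp: sym_pos_def_mat_def)
  then show ?thesis
    using scalar_prod_self_pos[OF v(1,2)] by (simp add: zero_less_mult_iff)
qed

text \<open>Any real eigenvalue separates the two; \<open>rayleigh_minimum\<close> provides
  one.\<close>

lemma lambda_min_le_max:
  assumes "A \<in> carrier_mat n n" "transpose_mat A = A" "0 < n"
  shows "lambda_min A \<le> lambda_max A"
proof -
  obtain \<mu> where "eigenvalue A \<mu>" using rayleigh_minimum[OF assms] by metis
  then have "lambda_min A \<le> \<mu>" "\<mu> \<le> lambda_max A"
    using card_finite_spectrum(1)[OF assms(1)]
    by (auto simp: lambda_min_def lambda_max_def spectrum_def intro: Min_le Max_ge)
  then show ?thesis by simp
qed

section \<open>Decay of the estimation error\<close>

text \<open>Moving the transpose of P across the scalar product turns the form of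
  \<open>transpose_mat P * W * P\<close> at v into the form of W at P v. With c = \<eta>^2 this is
  one contraction step of the Lyapunov function.\<close>

lemma lyapunov_form_step:
  fixes W P :: "real mat"
  assumes W: "W \<in> carrier_mat n n" and P: "P \<in> carrier_mat n n"
    and neg: "neg_semidef_mat n (transpose_mat P * W * P - c \<cdot>\<^sub>m W)"
    and v: "v \<in> carrier_vec n"
  shows "scalar_prod (P *\<^sub>v v) (W *\<^sub>v (P *\<^sub>v v)) \<le> c * scalar_prod v (W *\<^sub>v v)"
proof -
  have "0 \<ge> scalar_prod v ((transpose_mat P * W * P - c \<cdot>\<^sub>m W) *\<^sub>v v)"
    using neg v by (simp add: neg_semidef_mat_def)
  also have "(transpose_mat P * W * P - c \<cdot>\<^sub>m W) *\<^sub>v v =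
      transpose_mat P *\<^sub>v (W *\<^sub>v (P *\<^sub>v v)) - c \<cdot>\<^sub>v (W *\<^sub>v v)"
    using W P v
    by (simp add: minus_mult_distrib_mat_vec[of _ n n] smult_mat_mult_vec[of _ n n]
        assoc_mult_mat_vec[of _ n n _ n])
  also have "scalar_prod v \<dots> =
      scalar_prod v (transpose_mat P *\<^sub>v (W *\<^sub>v (P *\<^sub>v v))) - c * scalar_prod v (W *\<^sub>v v)"
    using W P v by (simp add: scalar_prod_minus_distrib[of _ n])
  also have "scalar_prod v (transpose_mat P *\<^sub>v (W *\<^sub>v (P *\<^sub>v v))) =
      scalar_prod (P *\<^sub>v v) (W *\<^sub>v (P *\<^sub>v v))"
  proof -
    have "scalar_prod v (transpose_mat P *\<^sub>v (W *\<^sub>v (P *\<^sub>v v))) =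
        scalar_prod (transpose_mat P *\<^sub>v (W *\<^sub>v (P *\<^sub>v v))) v"
      using W P v by (intro comm_scalar_prod[of _ n]) auto
    also have "\<dots> = scalar_prod (W *\<^sub>v (P *\<^sub>v v)) (P *\<^sub>v v)"
      using W P v by (intro transpose_vec_mult_scalar[of _ n n]) auto
    also have "\<dots> = scalar_prod (P *\<^sub>v v) (W *\<^sub>v (P *\<^sub>v v))"
      using W P v by (intro comm_scalar_prod[of _ n]) auto
    finally show ?thesis .
  qed
  finally show ?thesis by simp
qed

text \<open>Indices start at 0 here, as in the error matrix, and at 1 for the estimation errors.\<close>

definition err_coord ::
    "nat \<Rightarrow> (nat \<Rightarrow> nat \<Rightarrow> real ^ 3) \<Rightarrow> (nat \<Rightarrow> nat \<Rightarrow> real ^ 3) \<Rightarrow> 3 \<Rightarrow> nat \<Rightarrow> real Matrix.vec" where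
  "err_coord m l \<xi> c k = Matrix.vec m (\<lambda>i. vec_nth (est_error l \<xi> (Suc i) k) c)"

lemma err_coord_carrier [simp]: "err_coord m l \<xi> c k \<in> carrier_vec m"
  by (simp add: err_coord_def)

text \<open>Subtracting the observer recursion from the difference recursion of the obstacle cancels
  everything but errors: the observer is a copy of the obstacle model, corrected by the first
  error.\<close>

lemma est_error_step:
  assumes "obstacle_model ts m ob l" "observer ts m \<alpha> ob \<xi>" "i < m"
  shows "est_error l \<xi> (Suc i) (Suc k) = est_error l \<xi> (Suc i) k
    - (ts * \<alpha> (Suc i)) *\<^sub>R est_error l \<xi> 1 k
    + (if Suc i < m then ts *\<^sub>R est_error l \<xi> (Suc (Suc i)) k else 0)"
proof -
  have l: "l i (Suc k) = l i k + ts *\<^sub>R l (Suc i) k" "l 0 k = ob k" "l m k = 0"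
    using assms(1,3) by (auto simp: obstacle_model_def)
  show ?thesis
  proof (cases "Suc i < m")
    case True
    then have "\<xi> (Suc i) (Suc k) = \<xi> (Suc i) k
        + ts *\<^sub>R (\<xi> (Suc (Suc i)) k + \<alpha> (Suc i) *\<^sub>R (ob k - \<xi> 1 k))"
      using assms(2) by (auto simp: observer_def)
    with True l show ?thesis by (simp add: est_error_def algebra_simps)
  next
    \<comment> \<open>In the last component the observer has no successor state; this matches
      \<open>l m k = 0\<close> in the obstacle model.\<close>
    case False
    then have m: "m = Suc i" using assms(3) by simp
    have "\<xi> (Suc i) (Suc k) = \<xi> (Suc i) k + (ts * \<alpha> (Suc i)) *\<^sub>R (ob k - \<xi> 1 k)"
      using assms(2) by (auto simp: observer_def m)
    with False l m show ?thesis by (simp add: est_error_def algebra_simps)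
  qed
qed

text \<open>The error matrix acts on blocks in three-dimensional space by scalar entries, so each
  spatial coordinate evolves separately under the same m by m matrix.\<close>

lemma err_coord_step:
  assumes "obstacle_model ts m ob l" "observer ts m \<alpha> ob \<xi>"
  shows "err_coord m l \<xi> c (Suc k) = error_mat ts m \<alpha> *\<^sub>v err_coord m l \<xi> c k"
proof (rule eq_vecI)
  fix i assume "i < dim_vec (error_mat ts m \<alpha> *\<^sub>v err_coord m l \<xi> c k)"
  then have i: "i < m" by (simp add: error_mat_def)
  define e where "e j = vec_nth (est_error l \<xi> (Suc j) k) c" for j
  have "vec_index (error_mat ts m \<alpha> *\<^sub>v err_coord m l \<xi> c k) i =
      (\<Sum>j<m. error_mat ts m \<alpha> $$ (i, j) * e j)"
    using i by (simp add: error_mat_def err_coord_def scalar_prod_def e_def atLeast0LessThan)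
  \<comment> \<open>Row i splits into first column, diagonal and superdiagonal, each a sum with at
    most one nonzero term. For i = 0 the first two overlap at j = 0 and add up to the entry 1 - ts *
    \<alpha> 1.\<close>
  also have "\<dots> = (\<Sum>j<m. (if j = 0 then - ts * \<alpha> (Suc i) * e j else 0)
      + (if j = i then e j else 0) + (if j = Suc i then ts * e j else 0))"
    using i by (intro sum.cong) (auto simp: error_mat_def algebra_simps)
  also have "\<dots> = - ts * \<alpha> (Suc i) * e 0 + e i + (if Suc i < m then ts * e (Suc i) else 0)"
    using i by (simp add: sum.distrib)
  also have "\<dots> = vec_index (err_coord m l \<xi> c (Suc k)) i"
    using i by (simp add: err_coord_def est_error_step[OF assms i] e_def)
  finally show "vec_index (err_coord m l \<xi> c (Suc k)) i =
      vec_index (error_mat ts m \<alpha> *\<^sub>v err_coord m l \<xi> c k) i" by simp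
qed (simp add: error_mat_def err_coord_def)

text \<open>Exchanging the sums over components and spatial coordinates lets the eigenvalue bounds,
  proved for real vectors, be added up over the three coordinates.\<close>

lemma est_error_norm_power2:
  "(est_error_norm m l \<xi> k)\<^sup>2 =
    (\<Sum>c\<in>UNIV. scalar_prod (err_coord m l \<xi> c k) (err_coord m l \<xi> c k))"
proof -
  have "(est_error_norm m l \<xi> k)\<^sup>2 = (\<Sum>i=1..m. (norm (est_error l \<xi> i k))\<^sup>2)"
    by (simp add: est_error_norm_def L2_set_def sum_nonneg)
  also have "\<dots> = (\<Sum>i<m. (norm (est_error l \<xi> (Suc i) k))\<^sup>2)"
    by (rule sum.reindex_bij_witness[of _ Suc "\<lambda>i. i - 1"]) auto
  also have "\<dots> = (\<Sum>i<m. \<Sum>c\<in>UNIV. (vec_nth (est_error l \<xi> (Suc i) k) c)\<^sup>2)"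
    by (simp add: norm_vec_def L2_set_def sum_nonneg)
  also have "\<dots> = (\<Sum>c\<in>UNIV. \<Sum>i<m. (vec_nth (est_error l \<xi> (Suc i) k) c)\<^sup>2)"
    by (rule sum.swap)
  also have "\<dots> = (\<Sum>c\<in>UNIV. scalar_prod (err_coord m l \<xi> c k) (err_coord m l \<xi> c k))"
    by (simp add: scalar_prod_self_sum[where n = m]) (simp add: err_coord_def)
  finally show ?thesis .
qed

lemma norm_est_error_le:
  assumes "1 \<le> i" "i \<le> m"
  shows "norm (est_error l \<xi> i k) \<le> est_error_norm m l \<xi> k"
  unfolding est_error_norm_def using assms by (intro member_le_L2_set) auto

text \<open>The square root in \<open>phi\<close> is that of the condition number of W, the price of
  passing from the Euclidean norm to the form of W and back; the power of \<eta> is the decay of the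
  form in between.\<close>

lemma est_error_norm_bound:
  assumes m: "0 < m" and ob: "obstacle_model ts m ob l" "observer ts m \<alpha> ob \<xi>"
    and W: "sym_pos_def_mat m W"
    and neg: "neg_semidef_mat m
           (transpose_mat (error_mat ts m \<alpha>) * W * error_mat ts m \<alpha> - (\<eta>\<^sup>2) \<cdot>\<^sub>m W)"
    and \<eta>: "0 \<le> \<eta>"
  shows "est_error_norm m l \<xi> k \<le> est_error_norm m l \<xi> 0 * phi W \<eta> k"
proof -
  have WC: "W \<in> carrier_mat m m" "transpose_mat W = W"
    using W by (auto simp: sym_pos_def_mat_def)
  let ?v = "err_coord m l \<xi>"
  have P: "error_mat ts m \<alpha> \<in> carrier_mat m m" by (simp add: error_mat_def)
  define V where "V k = (\<Sum>c\<in>UNIV. scalar_prod (?v c k) (W *\<^sub>v ?v c k))" for k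
  have step: "V (Suc k) \<le> \<eta>\<^sup>2 * V k" for k
    unfolding V_def sum_distrib_left err_coord_step[OF ob]
    by (intro sum_mono lyapunov_form_step[OF WC(1) P neg]) simp
  have decay: "V k \<le> (\<eta> ^ k)\<^sup>2 * V 0" for k
  proof (induction k)
    case (Suc k)
    have "\<eta>\<^sup>2 * V k \<le> \<eta>\<^sup>2 * ((\<eta> ^ k)\<^sup>2 * V 0)" using Suc by (intro mult_left_mono) auto
    then show ?case using step[of k] by (simp add: power_mult_distrib mult_ac)
  qed simp
  have low: "lambda_min W * (est_error_norm m l \<xi> k)\<^sup>2 \<le> V k" for k
    unfolding V_def est_error_norm_power2 sum_distrib_left
    by (intro sum_mono lambda_min_bound[OF WC m]) simp
  have high: "V k \<le> lambda_max W * (est_error_norm m l \<xi> k)\<^sup>2" for k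
    unfolding V_def est_error_norm_power2 sum_distrib_left
    by (intro sum_mono lambda_max_bound[OF WC m]) simp
  have pos: "0 < lambda_min W" by (rule lambda_min_pos[OF W m])
  have "lambda_min W * (est_error_norm m l \<xi> k)\<^sup>2
      \<le> (\<eta> ^ k)\<^sup>2 * (lambda_max W * (est_error_norm m l \<xi> 0)\<^sup>2)"
    using low[of k] decay[of k] mult_left_mono[OF high[of 0], of "(\<eta> ^ k)\<^sup>2"] by simp
  then have "(est_error_norm m l \<xi> k)\<^sup>2
      \<le> (\<eta> ^ k * est_error_norm m l \<xi> 0)\<^sup>2 * (lambda_max W / lambda_min W)"
    using pos by (simp add: field_simps)
  then have "est_error_norm m l \<xi> k
      \<le> sqrt ((\<eta> ^ k * est_error_norm m l \<xi> 0)\<^sup>2 * (lambda_max W / lambda_min W))"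
    by (rule real_le_rsqrt)
  \<comment> \<open>The root of the square is an absolute value, which drops because \<eta> and the
    error norm are nonnegative.\<close>
  also have "\<dots> = est_error_norm m l \<xi> 0 * phi W \<eta> k"
    using \<eta> by (simp only: real_sqrt_mult phi_def)
      (simp add: abs_mult est_error_norm_def)
  finally show ?thesis .
qed

section \<open>Invariance of the safe set\<close>

lemma spectral_radius_nonneg:
  assumes "A \<in> carrier_mat n n" "0 < n"
  shows "0 \<le> spectral_radius A"
  using spectral_radius_mem_max(1)[OF assms] by auto

text \<open>One step of the criterion controls the distance to the estimate, and passing to the true
  obstacle uses up the margin. What results is membership in the safe set, not H \<ge> 0 at the true
  position. The induction therefore runs on membership, and \<open>cbfsc_trajectories\<close>
  supplies H \<ge> 0 anew at each safe step.\<close>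

theorem theorem1:
  fixes ts dmin Ro \<delta> \<eta> :: real and m :: nat
    and \<alpha> :: "nat \<Rightarrow> real" and W :: "real mat"
    and ob :: "nat \<Rightarrow> real ^ 3" and l \<xi> :: "nat \<Rightarrow> nat \<Rightarrow> real ^ 3"
    and J :: "real ^ 'n \<Rightarrow> real ^ 'n ^ 7"
    and Xe :: "(real ^ 7) set" and U :: "(real ^ 'n) set"
  assumes "ts > 0" and "m \<ge> 1"
    and "obstacle_model ts m ob l"
    and "observer ts m \<alpha> ob \<xi>"
    and "spectral_radius (map_mat complex_of_real (error_mat ts m \<alpha>)) < 1"
    and "spectral_radius (map_mat complex_of_real (error_mat ts m \<alpha>)) < \<eta>" and "\<eta> < 1"
    and "sym_pos_def_mat m W"
    and "neg_semidef_mat m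
           (transpose_mat (error_mat ts m \<alpha>) * W * error_mat ts m \<alpha> - (\<eta>\<^sup>2) \<cdot>\<^sub>m W)"
    and "est_error_norm m l \<xi> 0 \<le> \<delta>"
  defines "r \<equiv> r_safe dmin Ro \<delta> W \<eta>"
    and "S \<equiv> safe_set dmin Ro Xe ob"
  shows "(\<forall>\<theta> x u \<gamma> k. ee_trajectory ts J Xe U \<theta> x u \<and>
            x k \<in> S k \<and> H r (x k) (ob k) \<ge> 0 \<and> CBFSC ts J r ob \<xi> \<theta> x u \<gamma> k \<longrightarrow>
            x (Suc k) \<in> S (Suc k)) \<and>
         forward_invariant (cbfsc_trajectories ts J Xe U r ob \<xi> S) S"
proof -
  have m: "0 < m" using assms(2) by simp
  \<comment> \<open>Only \<eta> above the spectral radius is given; its sign follows from the radius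
    being nonnegative.\<close>
  have "0 \<le> spectral_radius (map_mat complex_of_real (error_mat ts m \<alpha>))"
    by (rule spectral_radius_nonneg[OF _ m]) (simp add: error_mat_def)
  then have \<eta>: "0 \<le> \<eta>" "\<eta> \<le> 1" using assms(6,7) by auto
  have err: "norm (ob k - \<xi> 1 k) \<le> \<delta> * phi W \<eta> 0" for k
  proof -
    have ratio: "0 \<le> sqrt (lambda_max W / lambda_min W)"
      using lambda_min_pos[OF assms(8) m] lambda_min_le_max[of W m] m assms(8)
      by (force simp: sym_pos_def_mat_def)
    have "l 0 k = ob k" using assms(3) by (simp add: obstacle_model_def)
    then have "norm (ob k - \<xi> 1 k) = norm (est_error l \<xi> 1 k)" by (simp add: est_error_def)
    also have "\<dots> \<le> est_error_norm m l \<xi> k"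
      using m by (intro norm_est_error_le) auto
    also have "\<dots> \<le> est_error_norm m l \<xi> 0 * phi W \<eta> k"
      by (rule est_error_norm_bound[OF m assms(3,4,8,9) \<eta>(1)])
    \<comment> \<open>The safety distance is constant in time, so the decaying bound is replaced by
      its value at step 0, the largest one since \<eta> \<le> 1.\<close>
    also have "\<dots> \<le> \<delta> * phi W \<eta> 0"
    proof (rule mult_mono)
      have "\<eta> ^ k \<le> 1" using \<eta> by (intro power_le_one)
      then show "phi W \<eta> k \<le> phi W \<eta> 0"
        using mult_right_mono[of "\<eta> ^ k" 1, OF _ ratio] by (simp add: phi_def)
      have "0 \<le> est_error_norm m l \<xi> 0" by (simp add: est_error_norm_def)
      then show "0 \<le> \<delta>" using assms(10) by simp
      show "0 \<le> phi W \<eta> k" using ratio \<eta> by (simp add: phi_def)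
    qed (rule assms(10))
    finally show ?thesis .
  qed
  have step: "x (Suc k) \<in> S (Suc k)"
    if "ee_trajectory ts J Xe U \<theta> x u" "H r (x k) (ob k) \<ge> 0" "CBFSC ts J r ob \<xi> \<theta> x u \<gamma> k"
    for \<theta> x u \<gamma> k
  proof -
    have x: "x (Suc k) \<in> Xe" "ee_step ts J (\<theta> k) (x k) (u k) = x (Suc k)"
      using that(1) unfolding ee_trajectory_def by metis+
    \<comment> \<open>The criterion says that H at the next pose and the next estimate is at least
      (1 - \<gamma> k) times the current H, and \<gamma> k \<le> 1 makes this nonnegative.\<close>
    have "0 \<le> (1 - \<gamma> k) * H r (x k) (ob k)"
      using that(2,3) by (auto simp: CBFSC_def)
    also have "\<dots> \<le> H r (x (Suc k)) (\<xi> 1 (Suc k))"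
      using that(3) by (simp add: CBFSC_def x(2) algebra_simps)
    finally have "r \<le> norm (ee_pos (x (Suc k)) - \<xi> 1 (Suc k))"
      by (simp add: H_def)
    \<comment> \<open>The last summand is at most \<delta> * phi W \<eta> 0, so subtracting it from
      r leaves exactly dmin + Ro.\<close>
    also have "\<dots> \<le> norm (ee_pos (x (Suc k)) - ob (Suc k)) + norm (ob (Suc k) - \<xi> 1 (Suc k))"
      using norm_triangle_ineq[of "ee_pos (x (Suc k)) - ob (Suc k)" "ob (Suc k) - \<xi> 1 (Suc k)"]
      by simp
    finally have "0 \<le> h_e dmin Ro (x (Suc k)) (ob (Suc k))"
      using err[of "Suc k"] by (simp add: r_def r_safe_def h_e_def)
    with x(1) show ?thesis by (simp add: S_def safe_set_def)
  qed
  have "x k \<in> S k"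
    if x: "x \<in> cbfsc_trajectories ts J Xe U r ob \<xi> S" "x 0 \<in> S 0" for x k
  proof (induction k)
    case (Suc k)
    from x(1) obtain \<theta> u \<gamma> where "ee_trajectory ts J Xe U \<theta> x u"
      "\<And>k. x k \<in> S k \<Longrightarrow> H r (x k) (ob k) \<ge> 0 \<and> CBFSC ts J r ob \<xi> \<theta> x u \<gamma> k"
      by (auto simp: cbfsc_trajectories_def)
    with Suc step show ?case by blast
  qed (rule x(2))
  then show ?thesis using step by (auto simp: forward_invariant_def)
qed

end
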